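(* Let $(T_L,T_R)$ be a pair of twin BSTMs with $k$ nodes and let $X \in \mathbb{N}^k$ be such that $X_i$ is the multiplicity of the $i$-th node of the trees. Then $$\mathcal{L}(Q[X;T_L;T_R]) = \sum_{L} \sum_{R} \mathcal{L}(P[Y_{L};\lambda_L \lambda_R^{-1}]),$$ where the first sum is over all linear extensions $L$ of $\Delta(T_L)$; the second sum is over all linear extensions $R$ of $\nabla(T_R,p_L)$, where $a < x$ in $p_L$ if and only if $a$ is simple in $(T_L,T_R)$ and $a < x$ in $L$; and $(Y_{L})_i = X_{\lambda_L^{-1}(i)}$ for $1\le i\le k$.
   Context: $\mathbb{N}=\{1,2,\dots\}$, $[k]=\{1,\dots,k\}$. $\mathcal{L}(P)$ is the number of linear extensions of a finite poset $P$ (total orders on its underlying set containing the partial order). Binary trees are rooted planar binary trees; the $i$-th node is the $i$-th node in the inorder traversal. A binary search tree with multiplicities (BSTM) is a binary tree whose nodes are labelled by pairwise distinct letters of $\mathbb{N}$ forming a binary search tree (left subtree letters strictly smaller, right subtree letters strictly greater), each node also carrying a positive integer multiplicity. A pair $(T_L,T_R)$ of BSTMs is a pair of twin BSTMs if they have the same letters with the same multiplicities and, for all $i$, if the $i$-th node of $T_L$ has multiplicity 1 and has a left (resp. right) child, then the $i$-th node of $T_R$ has no left (resp. right) child. An index $a\in[k]$ is simple in $(T_L,T_R)$ if the $a$-th node has multiplicity 1. For a binary tree $T$ with $k$ nodes, $\Delta(T)$ (resp. $\nabla(T)$) is the partial order on $[k]$ with $i\le j$ iff the $i$-th node is equal to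 or an ancestor (resp. a descendant) of the $j$-th node of $T$. For a partial order $p$ on $[k]$, $\nabla(T_R,p)$ is $\nabla(T_R)$ with the extra condition that $i\le j$ whenever $i\le j$ in $p$; thus a linear extension of $\nabla(T_R,p)$ is a total order on $[k]$ containing both $\nabla(T_R)$ and $p$. For a total order $C$ on $[k]$, $\lambda_C:[k]\to[k]$ sends $x$ to $m$ if $x$ is the $m$-th least element of $C$. $\lambda_L\lambda_R^{-1}$ is the permutation $i\mapsto\lambda_L(\lambda_R^{-1}(i))$. $Q[X;T_L;T_R]$ is the poset built by taking $k$ disjoint chains, the $i$-th having $X_i$ elements, and requiring the least (resp. greatest) element of the $i$-th chain to be less than the least (resp. greatest) element of the $j$-th chain whenever $i<j$ in $\Delta(T_L)$ (resp. $\nabla(T_R)$); the order is generated by these relations. For $Y=(Y_1,\dots,Y_k)\in\mathbb{N}^k$ and a permutation $\tau$ of $[k]$, $P[Y;\tau]$ is the poset built by taking $k$ disjoint chains, the $i$-th having $Y_i$ elements, and requiring, for $1\le i<k$, the least element of the $i$-th chain to be less than the least element of the $(i+1)$-th chain, and the greatest element of the $\tau_i$-th chain to be less than the greatest element of the $\tau_{i+1}$-th chain; the order is generated by these relations. *)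

theory Defs
  imports Main "HOL-Library.Tree" "HOL-Library.Sublist"
begin

section \<open>Linear extensions\<close>

text \<open>A finite poset is a pair of its underlying set and its (reflexive) order relation.\<close>

type_synonym 'a poset = "'a set \<times> 'a rel"

definition linear_extensions :: "'a poset \<Rightarrow> 'a rel set" where
  "linear_extensions P = {C. linear_order_on (fst P) C \<and> snd P \<subseteq> C}"

definition num_linear_extensions :: "'a poset \<Rightarrow> nat" where
  "num_linear_extensions P = card (linear_extensions P)"

text \<open>The set \<open>A\<close> ordered by the reflexive transitive closure of the relations \<open>G\<close>.  When
  \<open>G\<close> is cyclic the closure is not antisymmetric, and there are no linear extensions.\<close>

definition generated_poset :: "'a set \<Rightarrow> 'a rel \<Rightarrow> 'a poset" where
  "generated_poset A G = (A, G\<^sup>* \<inter> A \<times> A)"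

definition rank :: "'a rel \<Rightarrow> 'a \<Rightarrow> nat" where
  "rank C x = card {y. (y, x) \<in> C}"

text \<open>For a total order \<open>C\<close> (reflexive, on a finite set), \<open>rank C x = m\<close> iff \<open>x\<close> is the
  \<open>m\<close>-th least element, counting from 1: this is the map \<open>\<lambda>\<^sub>C\<close>.\<close>

definition unrank :: "nat \<Rightarrow> nat rel \<Rightarrow> nat \<Rightarrow> nat" where
  "unrank k C = inv_into {1..k} (rank C)"


section \<open>Binary trees and their nodes\<close>

text \<open>A node is identified with the sequence of left/right steps leading to it from the root;
  the nodes are listed in the order of the inorder traversal.\<close>

datatype side = Lft | Rgt

fun nodes :: "'a tree \<Rightarrow> side list list" where
  "nodes \<langle>\<rangle> = []"
| "nodes \<langle>l, a, r\<rangle> = map ((#) Lft) (nodes l) @ [[]] @ map ((#) Rgt) (nodes r)"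

lemma length_nodes [simp]: "length (nodes T) = size T"
  by (induction T) auto

definition nth_node :: "'a tree \<Rightarrow> nat \<Rightarrow> side list" where
  "nth_node T i = nodes T ! (i - 1)"

definition has_child :: "side \<Rightarrow> 'a tree \<Rightarrow> nat \<Rightarrow> bool" where
  "has_child d T i \<longleftrightarrow> nth_node T i @ [d] \<in> set (nodes T)"

text \<open>A node is equal to or an ancestor of another one iff its path is a prefix.\<close>

definition Delta_rel :: "'a tree \<Rightarrow> nat rel" where
  "Delta_rel T = {(i, j). i \<in> {1..size T} \<and> j \<in> {1..size T} \<and> prefix (nth_node T i) (nth_node T j)}"

definition Nabla_rel :: "'a tree \<Rightarrow> nat rel" where
  "Nabla_rel T = {(i, j). i \<in> {1..size T} \<and> j \<in> {1..size T} \<and> prefix (nth_node T j) (nth_node T i)}"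

definition Delta :: "'a tree \<Rightarrow> nat poset" where
  "Delta T = ({1..size T}, Delta_rel T)"

definition Nabla_with :: "'a tree \<Rightarrow> nat rel \<Rightarrow> nat poset" where
  "Nabla_with T p = generated_poset {1..size T} (Nabla_rel T \<union> p)"


section \<open>Binary search trees with multiplicities\<close>

text \<open>A label is a pair of a letter and its multiplicity.\<close>

type_synonym bstm = "(nat \<times> nat) tree"

definition is_bstm :: "bstm \<Rightarrow> bool" where
  "is_bstm T \<longleftrightarrow> bst (map_tree fst T) \<and> (\<forall>(a, m) \<in> set_tree T. a \<ge> 1 \<and> m \<ge> 1)"

definition multiplicity :: "bstm \<Rightarrow> nat \<Rightarrow> nat" where
  "multiplicity T i = snd (inorder T ! (i - 1))"

text \<open>Within a BSTM the letters are pairwise distinct, so equality of the sets of labels says that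
  both trees have the same letters with the same multiplicities; consequently their
  \<open>i\<close>-th nodes in inorder carry the same label.\<close>

definition twin_bstms :: "bstm \<Rightarrow> bstm \<Rightarrow> bool" where
  "twin_bstms TL TR \<longleftrightarrow>
     is_bstm TL \<and> is_bstm TR \<and> set_tree TL = set_tree TR \<and>
     (\<forall>i \<in> {1..size TL}. \<forall>d. multiplicity TL i = 1 \<and> has_child d TL i \<longrightarrow> \<not> has_child d TR i)"

lemma twin_bstms_inorder_eq:
  assumes "twin_bstms TL TR"
  shows "inorder TL = inorder TR"
proof -
  have sorted: "sorted_wrt (<) (map fst (inorder T))" if "is_bstm T" for T :: bstm
    using that by (simp add: is_bstm_def bst_iff_sorted_wrt_less inorder_map)
  have "map fst (inorder TL) = map fst (inorder TR)"
    using assms sorted by (intro strict_sorted_equal) (auto simp: twin_bstms_def)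
  moreover have "inj_on fst (set (inorder TL) \<union> set (inorder TR))"
    using assms sorted[of TL]
    by (simp add: twin_bstms_def strict_sorted_iff distinct_map)
  ultimately show ?thesis
    by (simp add: map_inj_on)
qed

text \<open>By the preceding lemma, the multiplicity may be read off either tree.\<close>

definition simple_index :: "bstm \<Rightarrow> bstm \<Rightarrow> nat \<Rightarrow> bool" where
  "simple_index TL TR a \<longleftrightarrow> a \<in> {1..size TL} \<and> multiplicity TL a = 1"

definition simple_order :: "bstm \<Rightarrow> bstm \<Rightarrow> nat rel \<Rightarrow> nat rel" where
  "simple_order TL TR L =
     {(a, x). a \<in> {1..size TL} \<and> x \<in> {1..size TL} \<and>
              (a = x \<or> simple_index TL TR a \<and> (a, x) \<in> L \<and> a \<noteq> x)}"


section \<open>The posets \<open>Q[X;T\<^sub>L;T\<^sub>R]\<close> and \<open>P[Y;\<tau>]\<close>\<close>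

text \<open>The element \<open>(i, a)\<close> is the \<open>a\<close>-th least element of the \<open>i\<close>-th chain, which has
  \<open>X i\<close> elements.  Vectors indexed by \<open>[k]\<close> are functions; only their values on
  \<open>{1..k}\<close> are used.\<close>

definition chain_set :: "nat \<Rightarrow> (nat \<Rightarrow> nat) \<Rightarrow> (nat \<times> nat) set" where
  "chain_set k X = {(i, a). i \<in> {1..k} \<and> a \<in> {1..X i}}"

definition chain_rel :: "nat \<Rightarrow> (nat \<Rightarrow> nat) \<Rightarrow> (nat \<times> nat) rel" where
  "chain_rel k X = {((i, a), (i, b)) | i a b. i \<in> {1..k} \<and> 1 \<le> a \<and> a \<le> b \<and> b \<le> X i}"

definition Q_poset :: "(nat \<Rightarrow> nat) \<Rightarrow> bstm \<Rightarrow> bstm \<Rightarrow> (nat \<times> nat) poset" where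
  "Q_poset X TL TR = generated_poset (chain_set (size TL) X)
     (chain_rel (size TL) X
      \<union> {((i, 1), (j, 1)) | i j. (i, j) \<in> Delta_rel TL \<and> i \<noteq> j}
      \<union> {((i, X i), (j, X j)) | i j. (i, j) \<in> Nabla_rel TR \<and> i \<noteq> j})"

definition P_poset :: "nat \<Rightarrow> (nat \<Rightarrow> nat) \<Rightarrow> (nat \<Rightarrow> nat) \<Rightarrow> (nat \<times> nat) poset" where
  "P_poset k Y \<tau> = generated_poset (chain_set k Y)
     (chain_rel k Y
      \<union> {((i, 1), (i + 1, 1)) | i. 1 \<le> i \<and> i < k}
      \<union> {((\<tau> i, Y (\<tau> i)), (\<tau> (i + 1), Y (\<tau> (i + 1)))) | i. 1 \<le> i \<and> i < k})"

end

theory Submission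
  imports Defs
begin

text \<open>A linear extension \<open>C\<close> of \<open>Q[X;T\<^sub>L;T\<^sub>R]\<close> orders \<open>[k]\<close> in two ways, by comparing the least
  elements of the chains and by comparing their greatest elements; call these orders \<open>L\<close> and \<open>R\<close>.
  They are linear extensions of \<open>\<Delta>(T\<^sub>L)\<close> and of \<open>\<nabla>(T\<^sub>R,p\<^sub>L)\<close>, the relations of \<open>p\<^sub>L\<close> being forced because
  a simple index has a one-element chain.  Conversely, relabelling the \<open>i\<close>-th chain as the
  \<open>\<lambda>\<^sub>L(i)\<close>-th one turns the extensions with prescribed \<open>L\<close> and \<open>R\<close> into the linear extensions
  of \<open>P[Y\<^sub>L;\<lambda>\<^sub>L\<lambda>\<^sub>R\<^sup>-\<^sup>1]\<close>.\<close>

section \<open>Linear orders and linear extensions\<close>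

lemma linear_order_onD:
  assumes "linear_order_on A C"
  shows "C \<subseteq> A \<times> A" "x \<in> A \<Longrightarrow> (x, x) \<in> C"
    "(x, y) \<in> C \<Longrightarrow> (y, z) \<in> C \<Longrightarrow> (x, z) \<in> C"
    "(x, y) \<in> C \<Longrightarrow> (y, x) \<in> C \<Longrightarrow> x = y"
    "x \<in> A \<Longrightarrow> y \<in> A \<Longrightarrow> (x, y) \<in> C \<or> (y, x) \<in> C"
proof -
  have C: "C \<subseteq> A \<times> A" "refl_on A C" "trans C" "antisym C" "total_on A C"
    using assms by (simp_all add: order_on_defs)
  show "C \<subseteq> A \<times> A" by (rule C)
  show "(x, x) \<in> C" if "x \<in> A" using refl_onD[OF C(2) that] .
  show "(x, z) \<in> C" if "(x, y) \<in> C" "(y, z) \<in> C" using transD[OF C(3) that] .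
  show "x = y" if "(x, y) \<in> C" "(y, x) \<in> C" using antisymD[OF C(4) that] .
  show "(x, y) \<in> C \<or> (y, x) \<in> C" if "x \<in> A" "y \<in> A"
    using C(2,5) that by (cases "x = y") (auto simp: refl_on_def total_on_def)
qed

lemma linear_order_onI:
  assumes "C \<subseteq> A \<times> A" "\<And>x. x \<in> A \<Longrightarrow> (x, x) \<in> C"
    "\<And>x y z. (x, y) \<in> C \<Longrightarrow> (y, z) \<in> C \<Longrightarrow> (x, z) \<in> C"
    "\<And>x y. (x, y) \<in> C \<Longrightarrow> (y, x) \<in> C \<Longrightarrow> x = y"
    "\<And>x y. x \<in> A \<Longrightarrow> y \<in> A \<Longrightarrow> (x, y) \<in> C \<or> (y, x) \<in> C"
  shows "linear_order_on A C"
  unfolding linear_order_on_def partial_order_on_def preorder_on_def refl_on_def total_on_def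
  by (intro conjI transI antisymI ballI impI) (fact assms | rule assms; assumption)+

text \<open>A pair of \<open>M\<close> missing from \<open>L\<close> would be reversed in
  \<open>L\<close> by totality, hence in \<open>M\<close>, and antisymmetry of \<open>M\<close>
  would make it a diagonal pair of \<open>L\<close>. So one inclusion suffices whenever two linear
  orders are compared.\<close>

lemma linear_order_on_subset_eq:
  assumes "linear_order_on A L" "linear_order_on A M" "L \<subseteq> M"
  shows "L = M"
proof
  show "M \<subseteq> L"
  proof
    fix p assume p: "p \<in> M"
    obtain x y where [simp]: "p = (x, y)" by (cases p)
    have xy: "x \<in> A" "y \<in> A" using p linear_order_onD(1)[OF assms(2)] by auto
    show "p \<in> L"
    proof (rule ccontr)
      assume "p \<notin> L"
      then have "(y, x) \<in> L" using linear_order_onD(5)[OF assms(1) xy] by simp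
      with assms(3) p have "x = y" using linear_order_onD(4)[OF assms(2)] by auto
      with \<open>p \<notin> L\<close> \<open>(y, x) \<in> L\<close> show False by simp
    qed
  qed
qed (rule assms(3))

lemma linear_order_on_map:
  assumes "linear_order_on A C" "inj_on f A"
  shows "linear_order_on (f ` A) (map_prod f f ` C)"
proof (rule linear_order_onI)
  note C = linear_order_onD[OF assms(1)]
  show "map_prod f f ` C \<subseteq> f ` A \<times> f ` A" using C(1) by auto
  show "(x, x) \<in> map_prod f f ` C" if "x \<in> f ` A" for x
    using that C(2) by force
  show "(x, y) \<in> map_prod f f ` C \<or> (y, x) \<in> map_prod f f ` C"
    if "x \<in> f ` A" "y \<in> f ` A" for x y
    using that C(5) by force
  show "x = y" if "(x, y) \<in> map_prod f f ` C" "(y, x) \<in> map_prod f f ` C" for x y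
  proof -
    from that obtain a b c d where "(a, b) \<in> C" "(c, d) \<in> C" "x = f a" "y = f b" "y = f c" "x = f d"
      by auto
    moreover from this have "a = d" "b = c"
      using C(1) inj_onD[OF assms(2)] by auto
    ultimately show ?thesis using C(4) by blast
  qed
  show "(x, z) \<in> map_prod f f ` C"
    if "(x, y) \<in> map_prod f f ` C" "(y, z) \<in> map_prod f f ` C" for x y z
  proof -
    from that obtain a b c d where "(a, b) \<in> C" "(c, d) \<in> C" "x = f a" "y = f b" "y = f c" "z = f d"
      by auto
    moreover from this have "b = c"
      using C(1) inj_onD[OF assms(2)] by auto
    ultimately show ?thesis using C(3) by force
  qed
qed

text \<open>Here \<open>f\<close> only has to map into \<open>A\<close>, not onto it. The cases of
  interest are the maps sending \<open>i\<close> to \<open>(i, 1)\<close> and to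
  \<open>(i, X i)\<close>, which yield \<open>min_order\<close> and
  \<open>max_order\<close>.\<close>

lemma linear_order_on_pullback:
  assumes "linear_order_on A C" "inj_on f B" "f ` B \<subseteq> A"
  shows "linear_order_on B {(x, y). x \<in> B \<and> y \<in> B \<and> (f x, f y) \<in> C}"
proof (rule linear_order_onI)
  note C = linear_order_onD[OF assms(1)]
  fix x y z
  let ?D = "{(x, y). x \<in> B \<and> y \<in> B \<and> (f x, f y) \<in> C}"
  show "(x, x) \<in> ?D" if "x \<in> B" using that C(2) assms(3) by auto
  show "(x, z) \<in> ?D" if "(x, y) \<in> ?D" "(y, z) \<in> ?D" using that C(3) by auto
  show "x = y" if "(x, y) \<in> ?D" "(y, x) \<in> ?D"
    using that C(4) inj_onD[OF assms(2)] by auto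
  show "(x, y) \<in> ?D \<or> (y, x) \<in> ?D" if "x \<in> B" "y \<in> B"
    using that C(5)[of "f x" "f y"] assms(3) by auto
qed auto

text \<open>A linear order on \<open>A\<close> is reflexive and transitive, so it absorbs the
  closure of any \<open>G\<close> it contains. This lets all later arguments work with generators
  only, and acyclicity is never an issue: for cyclic \<open>G\<close> both sides are empty.\<close>

lemma linear_extensions_generated_poset:
  assumes "G \<subseteq> A \<times> A"
  shows "linear_extensions (generated_poset A G) = {C. linear_order_on A C \<and> G \<subseteq> C}"
proof -
  have "G\<^sup>* \<inter> A \<times> A \<subseteq> C" if C: "linear_order_on A C" and G: "G \<subseteq> C" for C
  proof -
    \<comment> \<open>The start must lie in \<open>A\<close>, because \<open>G\<^sup>*\<close> also
      contains the diagonal pairs outside \<open>A\<close>.\<close>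
    have "(x, y) \<in> C" if "(x, y) \<in> G\<^sup>*" "x \<in> A" for x y
      using that
      by (induction rule: rtrancl_induct)
        (use G linear_order_onD(2,3)[OF C] in blast)+
    then show ?thesis by auto
  qed
  moreover have "G \<subseteq> G\<^sup>* \<inter> A \<times> A" using assms by auto
  ultimately show ?thesis
    unfolding linear_extensions_def generated_poset_def by auto
qed

lemma finite_linear_extensions:
  assumes "finite (fst P)"
  shows "finite (linear_extensions P)"
proof (rule finite_subset)
  show "linear_extensions P \<subseteq> Pow (fst P \<times> fst P)"
    unfolding linear_extensions_def using linear_order_onD(1) by fast
qed (use assms in simp)

lemma map_prod_inv_into:
  assumes "inj_on f A" "C \<subseteq> A \<times> A"
  shows "map_prod (inv_into A f) (inv_into A f) ` map_prod f f ` C = C"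
proof -
  have "(map_prod (inv_into A f) (inv_into A f) \<circ> map_prod f f) x = x" if "x \<in> C" for x
    using that assms by (cases x) auto
  then show ?thesis by (simp add: image_comp cong: image_cong)
qed

lemma map_prod_inv_into':
  assumes "C \<subseteq> f ` A \<times> f ` A"
  shows "map_prod f f ` map_prod (inv_into A f) (inv_into A f) ` C = C"
proof -
  have "(map_prod f f \<circ> map_prod (inv_into A f) (inv_into A f)) x = x" if "x \<in> C" for x
    using that assms by (cases x) (auto simp: f_inv_into_f)
  then show ?thesis by (simp add: image_comp cong: image_cong)
qed

text \<open>Transporting an order along \<open>f\<close> is undone by transporting it along
  \<open>inv_into A f\<close>, and both directions respect the generators. This justifies
  relabelling the chains.\<close>

lemma num_linear_extensions_map:
  assumes "inj_on f A" "G \<subseteq> A \<times> A"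
  shows "num_linear_extensions (generated_poset (f ` A) (map_prod f f ` G)) =
    num_linear_extensions (generated_poset A G)"
proof -
  let ?g = "inv_into A f"
  let ?S = "{C. linear_order_on A C \<and> G \<subseteq> C}"
  let ?T = "{C. linear_order_on (f ` A) C \<and> map_prod f f ` G \<subseteq> C}"
  have g: "inj_on ?g (f ` A)" "?g ` f ` A = A"
    using assms(1) by (auto simp: inj_on_inv_into image_image)
  have "bij_betw ((`) (map_prod f f)) ?S ?T"
  proof (rule bij_betw_byWitness[where f' = "(`) (map_prod ?g ?g)"])
    show "\<forall>C\<in>?S. map_prod ?g ?g ` map_prod f f ` C = C"
      by (auto simp only: mem_Collect_eq intro!: map_prod_inv_into[OF assms(1)] dest: linear_order_onD(1))
    show "\<forall>C\<in>?T. map_prod f f ` map_prod ?g ?g ` C = C"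
      by (auto simp only: mem_Collect_eq intro!: map_prod_inv_into' dest: linear_order_onD(1))
    show "(`) (map_prod f f) ` ?S \<subseteq> ?T"
      using linear_order_on_map[OF _ assms(1)] by blast
    show "(`) (map_prod ?g ?g) ` ?T \<subseteq> ?S"
    proof clarify
      fix C assume C: "linear_order_on (f ` A) C" "map_prod f f ` G \<subseteq> C"
      have "G = map_prod ?g ?g ` map_prod f f ` G"
        using map_prod_inv_into[OF assms] by simp
      also have "\<dots> \<subseteq> map_prod ?g ?g ` C" using C(2) by (rule image_mono)
      finally show "linear_order_on A (map_prod ?g ?g ` C) \<and> G \<subseteq> map_prod ?g ?g ` C"
        using linear_order_on_map[OF C(1) g(1)] g(2) by simp
    qed
  qed
  moreover have "map_prod f f ` G \<subseteq> f ` A \<times> f ` A" using assms(2) by auto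
  ultimately show ?thesis
    unfolding num_linear_extensions_def
    by (simp add: linear_extensions_generated_poset assms(2) bij_betw_same_card)
qed


section \<open>Ranks\<close>

text \<open>The down-sets counted by \<open>rank\<close> are nested by transitivity. If
  \<open>x\<close> is not below \<open>y\<close>, then \<open>x\<close> lies in its own down-set but
  not in that of \<open>y\<close>, so the count is strictly larger.\<close>

lemma rank_le_iff:
  assumes "linear_order_on A C" "finite A" "x \<in> A" "y \<in> A"
  shows "rank C x \<le> rank C y \<longleftrightarrow> (x, y) \<in> C"
proof -
  note C = linear_order_onD[OF assms(1)]
  have fin: "finite {z. (z, x) \<in> C}" for x
    by (rule finite_subset[OF _ assms(2)]) (use C(1) in auto)
  have le: "rank C x \<le> rank C y" if "(x, y) \<in> C" for x y
    unfolding rank_def by (rule card_mono[OF fin]) (use that C(3) in auto)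
  have "rank C y < rank C x" if "(x, y) \<notin> C"
    unfolding rank_def
  proof (rule psubset_card_mono[OF fin])
    have "(y, x) \<in> C" using that C(5) assms by auto
    moreover have "(x, x) \<in> C" using C(2) assms(3) by auto
    ultimately show "{z. (z, y) \<in> C} \<subset> {z. (z, x) \<in> C}"
      using that C(3) by blast
  qed
  then show ?thesis using le by force
qed

lemma bij_betw_rank:
  assumes "linear_order_on {1..k} C"
  shows "bij_betw (rank C) {1..k} {1..k}"
proof -
  note C = linear_order_onD[OF assms]
  have inj: "inj_on (rank C) {1..k}"
  proof (rule inj_onI)
    fix x y assume "x \<in> {1..k}" "y \<in> {1..k}" "rank C x = rank C y"
    then show "x = y" using rank_le_iff[OF assms] C(4) by (metis finite_atLeastAtMost order_refl)
  qed
  have "rank C x \<in> {1..k}" if "x \<in> {1..k}" for x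
  proof -
    have sub: "{y. (y, x) \<in> C} \<subseteq> {1..k}" using C(1) by auto
    then have "rank C x \<le> k" unfolding rank_def using card_mono[OF _ sub] by simp
    moreover have "rank C x > 0"
      unfolding rank_def card_gt_0_iff using C(2)[OF that] sub finite_subset by blast
    ultimately show ?thesis by simp
  qed
  \<comment> \<open>An injective map of a finite set into itself is onto, by counting.\<close>
  then have "rank C ` {1..k} = {1..k}"
    using inj by (intro card_subset_eq) (auto simp: card_image)
  with inj show ?thesis by (simp add: bij_betw_def)
qed

lemma
  assumes "linear_order_on {1..k} C"
  shows bij_betw_unrank: "bij_betw (unrank k C) {1..k} {1..k}"
    and rank_unrank: "i \<in> {1..k} \<Longrightarrow> rank C (unrank k C i) = i"
    and unrank_rank: "i \<in> {1..k} \<Longrightarrow> unrank k C (rank C i) = i"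
  using bij_betw_rank[OF assms] unfolding unrank_def
  by (auto intro: bij_betw_inv_into bij_betw_inv_into_right bij_betw_inv_into_left)

lemma unrank_in:
  assumes "linear_order_on {1..k} C" "i \<in> {1..k}"
  shows "unrank k C i \<in> {1..k}"
  using bij_betw_unrank[OF assms(1)] assms(2) bij_betwE by blast

text \<open>A finite linear order is determined by its consecutive pairs: they chain together to all
  pairs of \<open>L\<close>, so \<open>M\<close> contains \<open>L\<close> and equals it. This turns
  prescribing \<open>L\<close> or \<open>R\<close> into containing exactly the kind of generators
  that occur in \<open>P_poset\<close>.\<close>

lemma linear_order_eq_iff_unrank:
  assumes L: "linear_order_on {1..k} L" and M: "linear_order_on {1..k} M"
  shows "M = L \<longleftrightarrow> (\<forall>i. 1 \<le> i \<and> i < k \<longrightarrow> (unrank k L i, unrank k L (i + 1)) \<in> M)"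
proof
  assume "M = L"
  have "(unrank k L i, unrank k L (i + 1)) \<in> L" if "1 \<le> i" "i < k" for i
    using that rank_le_iff[OF L finite_atLeastAtMost unrank_in[OF L] unrank_in[OF L], of i "i + 1"]
    by (simp add: rank_unrank[OF L])
  with \<open>M = L\<close> show "\<forall>i. 1 \<le> i \<and> i < k \<longrightarrow> (unrank k L i, unrank k L (i + 1)) \<in> M" by simp
next
  assume step: "\<forall>i. 1 \<le> i \<and> i < k \<longrightarrow> (unrank k L i, unrank k L (i + 1)) \<in> M"
  have le: "(unrank k L i, unrank k L j) \<in> M" if "i \<le> j" "1 \<le> i" "j \<le> k" for i j
    using that
  proof (induction j rule: dec_induct)
    case base
    then show ?case using linear_order_onD(2)[OF M] unrank_in[OF L] by simp
  next
    case (step n)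
    then show ?case
      using \<open>\<forall>i. 1 \<le> i \<and> i < k \<longrightarrow> _\<close>[rule_format, of n] linear_order_onD(3)[OF M] by simp
  qed
  have "L \<subseteq> M"
  proof clarify
    fix x y assume xy: "(x, y) \<in> L"
    then have mem: "x \<in> {1..k}" "y \<in> {1..k}" using linear_order_onD(1)[OF L] by auto
    have "rank L x \<le> rank L y" using rank_le_iff[OF L _ mem] xy by simp
    moreover have "rank L x \<in> {1..k}" "rank L y \<in> {1..k}"
      using bij_betw_rank[OF L] mem bij_betwE by blast+
    ultimately show "(x, y) \<in> M" using le[of "rank L x" "rank L y"] mem unrank_rank[OF L] by simp
  qed
  then show "M = L" using linear_order_on_subset_eq[OF L M] by simp
qed


section \<open>The orders of the least and of the greatest elements of the chains\<close>

definition min_order :: "nat \<Rightarrow> (nat \<times> nat) rel \<Rightarrow> nat rel" where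
  "min_order k C = {(i, j). i \<in> {1..k} \<and> j \<in> {1..k} \<and> ((i, 1), (j, 1)) \<in> C}"

definition max_order :: "nat \<Rightarrow> (nat \<Rightarrow> nat) \<Rightarrow> (nat \<times> nat) rel \<Rightarrow> nat rel" where
  "max_order k X C = {(i, j). i \<in> {1..k} \<and> j \<in> {1..k} \<and> ((i, X i), (j, X j)) \<in> C}"

context
  fixes k :: nat and X :: "nat \<Rightarrow> nat"
  assumes X_pos: "\<forall>i\<in>{1..k}. X i \<ge> 1"
begin

text \<open>Positivity of \<open>X\<close> guarantees that the bottom \<open>(i, 1)\<close> of each
  chain is an actual element; the same holds for the top \<open>(i, X i)\<close> in the next
  lemma.\<close>

lemma linear_order_min_order:
  assumes "linear_order_on (chain_set k X) C"
  shows "linear_order_on {1..k} (min_order k C)"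
  unfolding min_order_def using X_pos
  by (intro linear_order_on_pullback[OF assms]) (auto simp: inj_on_def chain_set_def)

lemma linear_order_max_order:
  assumes "linear_order_on (chain_set k X) C"
  shows "linear_order_on {1..k} (max_order k X C)"
  unfolding max_order_def using X_pos
  by (intro linear_order_on_pullback[OF assms]) (auto simp: inj_on_def chain_set_def)

text \<open>Renaming chain \<open>i\<close> as chain \<open>rank L i\<close> identifies
  \<open>P_poset\<close> with a poset on the original chains. Its extra generators compare bottoms
  along consecutive elements of \<open>L\<close> and tops along consecutive elements of
  \<open>R\<close>, which forces \<open>min_order\<close> to be \<open>L\<close> and
  \<open>max_order\<close> to be \<open>R\<close>.\<close>

lemma num_linear_extensions_P_poset:
  assumes L: "linear_order_on {1..k} L" and R: "linear_order_on {1..k} R"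
  shows "num_linear_extensions
      (P_poset k (\<lambda>i. X (unrank k L i)) (\<lambda>i. rank L (unrank k R i))) =
    card {C. linear_order_on (chain_set k X) C \<and> chain_rel k X \<subseteq> C \<and>
      min_order k C = L \<and> max_order k X C = R}"
proof -
  let ?u = "unrank k L" and ?v = "unrank k R"
  let ?Y = "\<lambda>i. X (?u i)" and ?t = "\<lambda>i. rank L (?v i)"
  let ?f = "map_prod (rank L) id :: nat \<times> nat \<Rightarrow> nat \<times> nat"
  \<comment> \<open>These are the generators of \<open>P_poset\<close> in the original labels:
    \<open>?u i\<close> and \<open>?v i\<close> are the \<open>i\<close>-th elements of
    \<open>L\<close> and of \<open>R\<close>.\<close>
  define Gmin where "Gmin = {((?u i, 1::nat), (?u (i + 1), 1::nat)) | i. 1 \<le> i \<and> i < k}"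
  define Gmax where "Gmax = {((?v i, X (?v i)), (?v (i + 1), X (?v (i + 1)))) | i. 1 \<le> i \<and> i < k}"
  define G where "G = chain_rel k X \<union> Gmin \<union> Gmax"
  have rk: "rank L ` {1..k} = {1..k}" "inj_on (rank L) {1..k}"
    using bij_betw_rank[OF L] by (auto simp: bij_betw_def)
  have rin: "rank L i \<in> {1..k}" if "i \<in> {1..k}" for i using rk(1) that by blast
  have uin: "?u i \<in> {1..k}" if "i \<in> {1..k}" for i using unrank_in[OF L that] .
  have vin: "?v i \<in> {1..k}" if "i \<in> {1..k}" for i using unrank_in[OF R that] .
  have inj: "inj_on ?f (chain_set k X)"
    by (rule inj_on_subset[OF map_prod_inj_on[OF rk(2) inj_on_id]]) (auto simp: chain_set_def)
  have set_eq: "chain_set k ?Y = ?f ` chain_set k X"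
  proof (intro equalityI subsetI)
    fix p assume "p \<in> chain_set k ?Y"
    then obtain i a where p: "p = (i, a)" "i \<in> {1..k}" "a \<in> {1..?Y i}"
      by (auto simp: chain_set_def)
    then have "p = ?f (?u i, a)" "(?u i, a) \<in> chain_set k X"
      using uin[of i] rank_unrank[OF L] by (auto simp: chain_set_def)
    then show "p \<in> ?f ` chain_set k X" by blast
  qed (use rin unrank_rank[OF L] in \<open>auto simp: chain_set_def\<close>)
  have chain_eq: "chain_rel k ?Y = map_prod ?f ?f ` chain_rel k X"
  proof (intro equalityI subsetI)
    fix p assume "p \<in> chain_rel k ?Y"
    then obtain i a b where p: "p = ((i, a), (i, b))" "i \<in> {1..k}" "1 \<le> a" "a \<le> b" "b \<le> ?Y i"
      by (auto simp: chain_rel_def)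
    then have "p = map_prod ?f ?f ((?u i, a), (?u i, b))" "((?u i, a), (?u i, b)) \<in> chain_rel k X"
      using uin[of i] rank_unrank[OF L] by (auto simp: chain_rel_def)
    then show "p \<in> map_prod ?f ?f ` chain_rel k X" by blast
  qed (use rin unrank_rank[OF L] in \<open>auto simp: chain_rel_def\<close>)
  have min_eq: "{((i, 1), (i + 1, 1)) | i. 1 \<le> i \<and> i < k} = map_prod ?f ?f ` Gmin"
  proof -
    have "((i, 1), (i + 1, 1)) = map_prod ?f ?f ((?u i, 1), (?u (i + 1), 1))"
      if "1 \<le> i" "i < k" for i
      using that rank_unrank[OF L, of i] rank_unrank[OF L, of "i + 1"] by simp
    then show ?thesis unfolding Gmin_def setcompr_eq_image image_image
      by (intro image_cong) auto
  qed
  have max_eq: "{((?t i, ?Y (?t i)), (?t (i + 1), ?Y (?t (i + 1)))) | i. 1 \<le> i \<and> i < k} =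
    map_prod ?f ?f ` Gmax"
  proof -
    \<comment> \<open>Since \<open>?Y (?t i)\<close> unranks what \<open>rank L\<close> has just
      ranked, it equals \<open>X (?v i)\<close>; thus tops of chains correspond to tops.\<close>
    have "((?t i, ?Y (?t i)), (?t (i + 1), ?Y (?t (i + 1)))) =
      map_prod ?f ?f ((?v i, X (?v i)), (?v (i + 1), X (?v (i + 1))))"
      if "1 \<le> i" "i < k" for i
      using that unrank_rank[OF L] vin[of i] vin[of "i + 1"] by simp
    then show ?thesis unfolding Gmax_def setcompr_eq_image image_image
      by (intro image_cong) auto
  qed
  have G_sub: "G \<subseteq> chain_set k X \<times> chain_set k X"
  proof -
    have memmin: "(i, 1) \<in> chain_set k X" and memmax: "(i, X i) \<in> chain_set k X"
      if "i \<in> {1..k}" for i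
      using that X_pos by (auto simp: chain_set_def)
    have "chain_rel k X \<subseteq> chain_set k X \<times> chain_set k X"
      by (auto simp: chain_rel_def chain_set_def)
    moreover have "Gmin \<subseteq> chain_set k X \<times> chain_set k X"
      unfolding Gmin_def using memmin uin by auto
    moreover have "Gmax \<subseteq> chain_set k X \<times> chain_set k X"
      unfolding Gmax_def using memmax vin by auto
    ultimately show ?thesis unfolding G_def by blast
  qed
  have "P_poset k ?Y ?t = generated_poset (?f ` chain_set k X) (map_prod ?f ?f ` G)"
    unfolding P_poset_def G_def image_Un set_eq chain_eq min_eq max_eq ..
  then have "num_linear_extensions (P_poset k ?Y ?t) =
    card {C. linear_order_on (chain_set k X) C \<and> G \<subseteq> C}"
    using num_linear_extensions_map[OF inj G_sub] linear_extensions_generated_poset[OF G_sub]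
    by (simp add: num_linear_extensions_def)
  moreover have "G \<subseteq> C \<longleftrightarrow> chain_rel k X \<subseteq> C \<and> min_order k C = L \<and> max_order k X C = R"
    if C: "linear_order_on (chain_set k X) C" for C
  proof -
    have sub: "{g i | i. 1 \<le> i \<and> i < k} \<subseteq> C \<longleftrightarrow> (\<forall>i. 1 \<le> i \<and> i < k \<longrightarrow> g i \<in> C)" for g
      by blast
    have "min_order k C = L \<longleftrightarrow> Gmin \<subseteq> C"
      unfolding linear_order_eq_iff_unrank[OF L linear_order_min_order[OF C]]
      unfolding Gmin_def min_order_def sub using uin by auto
    moreover have "max_order k X C = R \<longleftrightarrow> Gmax \<subseteq> C"
      unfolding linear_order_eq_iff_unrank[OF R linear_order_max_order[OF C]]
      unfolding Gmax_def max_order_def sub using vin by auto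
    ultimately show ?thesis unfolding G_def by blast
  qed
  then have "{C. linear_order_on (chain_set k X) C \<and> G \<subseteq> C} =
      {C. linear_order_on (chain_set k X) C \<and> chain_rel k X \<subseteq> C \<and>
        min_order k C = L \<and> max_order k X C = R}"
    by (intro Collect_cong conj_cong refl)
  ultimately show ?thesis by simp
qed

lemma linear_extensions_Q_poset:
  assumes "size TL = k" "size TR = k"
  shows "linear_extensions (Q_poset X TL TR) =
    {C. linear_order_on (chain_set k X) C \<and> chain_rel k X \<subseteq> C \<and>
      Delta_rel TL \<subseteq> min_order k C \<and> Nabla_rel TR \<subseteq> max_order k X C}"
proof -
  define Dmin where "Dmin = {((i, 1::nat), (j, 1::nat)) | i j. (i, j) \<in> Delta_rel TL \<and> i \<noteq> j}"
  define Nmax where "Nmax = {((i, X i), (j, X j)) | i j. (i, j) \<in> Nabla_rel TR \<and> i \<noteq> j}"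
  let ?A = "chain_set k X"
  have D: "Delta_rel TL \<subseteq> {1..k} \<times> {1..k}" and N: "Nabla_rel TR \<subseteq> {1..k} \<times> {1..k}"
    using assms by (auto simp: Delta_rel_def Nabla_rel_def)
  have "chain_rel k X \<subseteq> ?A \<times> ?A" by (auto simp: chain_rel_def chain_set_def)
  moreover have "Dmin \<subseteq> ?A \<times> ?A" using D X_pos by (fastforce simp: Dmin_def chain_set_def)
  moreover have "Nmax \<subseteq> ?A \<times> ?A" using N X_pos by (fastforce simp: Nmax_def chain_set_def)
  ultimately have "linear_extensions (Q_poset X TL TR) =
    {C. linear_order_on ?A C \<and> chain_rel k X \<union> Dmin \<union> Nmax \<subseteq> C}"
    unfolding Q_poset_def assms(1) Dmin_def[symmetric] Nmax_def[symmetric]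
    by (intro linear_extensions_generated_poset) blast
  moreover have "Dmin \<subseteq> C \<longleftrightarrow> Delta_rel TL \<subseteq> min_order k C"
    if C: "linear_order_on ?A C" for C
  proof -
    \<comment> \<open>\<open>Delta_rel\<close> is reflexive while \<open>Dmin\<close> omits the
      diagonal; reflexivity of \<open>C\<close> supplies the missing pairs.\<close>
    have "((i, 1), (i, 1)) \<in> C" if "i \<in> {1..k}" for i
      using linear_order_onD(2)[OF C] that bspec[OF X_pos that] by (simp add: chain_set_def)
    with D show ?thesis unfolding min_order_def Dmin_def by fast
  qed
  moreover have "Nmax \<subseteq> C \<longleftrightarrow> Nabla_rel TR \<subseteq> max_order k X C"
    if C: "linear_order_on ?A C" for C
  proof -
    have "((i, X i), (i, X i)) \<in> C" if "i \<in> {1..k}" for i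
      using linear_order_onD(2)[OF C] that bspec[OF X_pos that] by (simp add: chain_set_def)
    with N show ?thesis unfolding max_order_def Nmax_def by fast
  qed
  ultimately show ?thesis by (simp cong: conj_cong)
qed

text \<open>The chain of a simple index \<open>a\<close> is a single element, at once bottom and
  top. If it is below the bottom of chain \<open>x\<close>, it is also below the top of chain
  \<open>x\<close>.\<close>

lemma simple_order_subset_max_order:
  assumes C: "linear_order_on (chain_set k X) C" and chain: "chain_rel k X \<subseteq> C"
    and size: "size TL = k" and X: "\<forall>i\<in>{1..k}. X i = multiplicity TL i"
  shows "simple_order TL TR (min_order k C) \<subseteq> max_order k X C"
proof clarify
  fix a x assume ax: "(a, x) \<in> simple_order TL TR (min_order k C)"
  then have mem: "a \<in> {1..k}" "x \<in> {1..k}" by (auto simp: simple_order_def size)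
  show "(a, x) \<in> max_order k X C"
  proof (cases "a = x")
    case True
    then show ?thesis
      using linear_order_onD(2)[OF linear_order_max_order[OF C]] mem by simp
  next
    case False
    with ax have "X a = 1" "((a, 1), (x, 1)) \<in> C"
      using bspec[OF X mem(1)] by (auto simp: simple_order_def simple_index_def min_order_def)
    moreover have "((x, 1), (x, X x)) \<in> C"
      using chain mem(2) bspec[OF X_pos mem(2)] by (auto simp: chain_rel_def)
    ultimately have "((a, X a), (x, X x)) \<in> C"
      by (metis linear_order_onD(3)[OF C])
    with mem show ?thesis by (simp add: max_order_def)
  qed
qed

end

section \<open>Counting linear extensions of Q by their orders of bottoms and tops\<close>

theorem theorem5p9:
  fixes TL TR :: bstm and k :: nat and X :: "nat \<Rightarrow> nat"
  assumes "twin_bstms TL TR"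
    and "size TL = k"
    and "\<And>i. i \<in> {1..k} \<Longrightarrow> X i = multiplicity TL i"
  shows "num_linear_extensions (Q_poset X TL TR) =
    (\<Sum>L \<in> linear_extensions (Delta TL).
      \<Sum>R \<in> linear_extensions (Nabla_with TR (simple_order TL TR L)).
        num_linear_extensions (P_poset k (\<lambda>i. X (unrank k L i)) (\<lambda>i. rank L (unrank k R i))))"
proof -
  have size: "size TR = k"
    using twin_bstms_inorder_eq[OF assms(1)] assms(2) by (metis length_inorder)
  have X_pos: "\<forall>i\<in>{1..k}. X i \<ge> 1"
  proof
    fix i assume i: "i \<in> {1..k}"
    \<comment> \<open>Nodes are numbered from 1 and lists from 0; the label found here has positive
      multiplicity because \<open>TL\<close> is a BSTM.\<close>
    have "inorder TL ! (i - 1) \<in> set_tree TL"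
      using i assms(2) by (metis One_nat_def Suc_pred atLeastAtMost_iff
          length_inorder less_eq_Suc_le nth_mem set_inorder)
    then show "X i \<ge> 1"
      using assms(1) assms(3)[OF i] by (force simp: twin_bstms_def is_bstm_def multiplicity_def)
  qed
  let ?A = "chain_set k X"
  let ?LD = "linear_extensions (Delta TL)"
  let ?RN = "\<lambda>L. linear_extensions (Nabla_with TR (simple_order TL TR L))"
  define S where "S = linear_extensions (Q_poset X TL TR)"
  define S' where "S' L = {C \<in> S. min_order k C = L}" for L
  note S_eq = linear_extensions_Q_poset[OF X_pos assms(2) size, folded S_def]
  have "chain_set k X = Sigma {1..k} (\<lambda>i. {1..X i})" by (auto simp: chain_set_def)
  then have "finite ?A" by simp
  then have "finite S"
    unfolding S_def Q_poset_def generated_poset_def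
    by (intro finite_linear_extensions) (simp add: assms(2))
  have D_ext: "?LD = {L. linear_order_on {1..k} L \<and> Delta_rel TL \<subseteq> L}"
    by (simp add: linear_extensions_def Delta_def assms(2))
  have N_ext: "?RN L = {R. linear_order_on {1..k} R \<and> Nabla_rel TR \<union> simple_order TL TR L \<subseteq> R}"
    for L
    unfolding Nabla_with_def size
    by (rule linear_extensions_generated_poset)
      (auto simp: Nabla_rel_def simple_order_def size assms(2))
  have fibre: "{C \<in> S' L. max_order k X C = R} = {C. linear_order_on ?A C \<and> chain_rel k X \<subseteq> C \<and>
      min_order k C = L \<and> max_order k X C = R}" if "L \<in> ?LD" "R \<in> ?RN L" for L R
    using that unfolding S'_def S_eq D_ext N_ext by blast
  have "num_linear_extensions (Q_poset X TL TR) = (\<Sum>C\<in>S. 1)"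
    by (simp add: num_linear_extensions_def S_def)
  \<comment> \<open>\<open>S\<close> is partitioned by the value of \<open>min_order\<close>, and
    then each \<open>S' L\<close> by that of \<open>max_order\<close>. It is enough that these
    values lie in the index sets: an empty fibre contributes 0.\<close>
  also have "\<dots> = (\<Sum>L\<in>?LD. \<Sum>C\<in>S' L. 1)"
    unfolding S'_def
  proof (rule sum.group[symmetric])
    show "finite S" by fact
    show "finite ?LD" by (rule finite_linear_extensions) (simp add: Delta_def)
    show "min_order k ` S \<subseteq> ?LD"
      unfolding D_ext S_eq using linear_order_min_order[OF X_pos] by blast
  qed
  also have "\<dots> = (\<Sum>L\<in>?LD. \<Sum>R\<in>?RN L.
      num_linear_extensions (P_poset k (\<lambda>i. X (unrank k L i)) (\<lambda>i. rank L (unrank k R i))))"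
  proof (rule sum.cong[OF refl])
    fix L assume L: "L \<in> ?LD"
    have "(\<Sum>C\<in>S' L. 1) = (\<Sum>R\<in>?RN L. \<Sum>C\<in>{C \<in> S' L. max_order k X C = R}. 1::nat)"
    proof (rule sum.group[symmetric])
      show "finite (S' L)" using \<open>finite S\<close> by (simp add: S'_def)
      show "finite (?RN L)"
        by (rule finite_linear_extensions) (simp add: Nabla_with_def generated_poset_def)
      \<comment> \<open>On \<open>S' L\<close> the order \<open>L\<close> is
        \<open>min_order k C\<close>, so the preceding bound on \<open>simple_order\<close> gives
        containment of the order p_L; the relations of \<open>Nabla_rel TR\<close> come from
        membership in \<open>S\<close>.\<close>
      show "max_order k X ` S' L \<subseteq> ?RN L"
        unfolding N_ext S'_def S_eq
        using linear_order_max_order[OF X_pos]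
          simple_order_subset_max_order[OF X_pos _ _ assms(2)] assms(3) by blast
    qed
    also have "\<dots> = (\<Sum>R\<in>?RN L.
        num_linear_extensions (P_poset k (\<lambda>i. X (unrank k L i)) (\<lambda>i. rank L (unrank k R i))))"
    proof (rule sum.cong[OF refl])
      fix R assume R: "R \<in> ?RN L"
      have "linear_order_on {1..k} L" "linear_order_on {1..k} R"
        using L R by (simp_all add: D_ext N_ext)
      from num_linear_extensions_P_poset[OF X_pos this] fibre[OF L R]
      show "(\<Sum>C\<in>{C \<in> S' L. max_order k X C = R}. 1) = num_linear_extensions
        (P_poset k (\<lambda>i. X (unrank k L i)) (\<lambda>i. rank L (unrank k R i)))"
        by simp
    qed
    finally show "(\<Sum>C\<in>S' L. 1) = (\<Sum>R\<in>?RN L.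
        num_linear_extensions (P_poset k (\<lambda>i. X (unrank k L i)) (\<lambda>i. rank L (unrank k R i))))" .
  qed
  finally show ?thesis .
qed

end
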